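(* For any integer $d\ge1$ and any $\alpha\in[0,1)$, $$q_L(\alpha,d,d)\ \ge\ \frac12\,(4d)^{-\frac{1}{1-\alpha}} .$$
   Context: Setting: site percolation on $\mathbb Z^{d+1}$. $\Omega=\{0,1\}^{\mathbb Z^{d+1}}$, and for $p\in[0,1]$, $\mathbb P_p$ is the product measure on $\Omega$ of Bernoulli distributions with parameter $p$. A site $x$ is open if $\omega(x)=1$ and closed if $\omega(x)=0$. A function $F:\mathbb Z^d\to\mathbb Z$ is Lipschitz if $|F(\bar x)-F(\bar y)|\le 1$ whenever $\Vert\bar x-\bar y\Vert_1=1$. For $\alpha\in[0,1)$ and $\eta\in\{-1,0,+1\}^d$, $\mathsf{LIP}^{\alpha,d}_\eta$ is the event of all $\omega\in\Omega$ for which there is a Lipschitz function $F$ such that for all $\bar x\in\mathbb Z^d$: $\omega((\bar x,F(\bar x)))=1$ and $F(\bar x)>\lfloor\alpha\sum_{i=1}^d\eta_i\bar x_i\rfloor$. Critical probability: there is a number $p_L(\alpha,d,\eta)\in(0,1)$ such that $\mathbb P_p(\mathsf{LIP}^{\alpha,d}_\eta)=0$ for $p<p_L(\alpha,d,\eta)$ and $=1$ for $p>p_L(\alpha,d,\eta)$; it depends on $\eta$ only through $k=\Vert\eta\Vert_1\in\{0,\dots,d\}$ and is written $p_L(\alpha,d,k)$. Put $q_L(\alpha,d,k):=1-p_L(\alpha,d,k)$. *)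

theory Defs
  imports "HOL-Probability.Probability"
begin

text \<open>
  The dimension is \<open>d = CARD('d)\<close>: an element of \<open>\<int>\<^sup>d\<close> is an \<open>int ^ 'd\<close>, and a site of
  \<open>\<int>\<^sup>d\<^sup>+\<^sup>1\<close> is a pair of a base point in \<open>\<int>\<^sup>d\<close> and a height. A configuration maps each site
  to \<open>True\<close> (open, 1) or \<open>False\<close> (closed, 0).
\<close>

type_synonym 'd site = "(int ^ 'd) \<times> int"

type_synonym 'd config = "'d site \<Rightarrow> bool"

definition norm1 :: "int ^ 'd::finite \<Rightarrow> int" where
  "norm1 x = (\<Sum>i\<in>UNIV. \<bar>x $ i\<bar>)"

definition percolation_measure :: "real \<Rightarrow> ('d::finite) config measure" where
  "percolation_measure p = (\<Pi>\<^sub>M s\<in>UNIV. measure_pmf (bernoulli_pmf p))"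

definition lipschitz_fun :: "(int ^ 'd::finite \<Rightarrow> int) \<Rightarrow> bool" where
  "lipschitz_fun F \<longleftrightarrow> (\<forall>x y. norm1 (x - y) = 1 \<longrightarrow> \<bar>F x - F y\<bar> \<le> 1)"

definition sign_vectors :: "(int ^ 'd::finite) set" where
  "sign_vectors = {\<eta>. \<forall>i. \<eta> $ i \<in> {-1, 0, 1}}"

definition LIP :: "real \<Rightarrow> int ^ 'd::finite \<Rightarrow> 'd config set" where
  "LIP \<alpha> \<eta> = {\<omega>. \<exists>F. lipschitz_fun F \<and>
     (\<forall>x. \<omega> (x, F x) \<and> F x > \<lfloor>\<alpha> * of_int (\<Sum>i\<in>UNIV. \<eta> $ i * x $ i)\<rfloor>)}"

definition critical_probability :: "real \<Rightarrow> int ^ 'd::finite \<Rightarrow> real \<Rightarrow> bool" where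
  "critical_probability \<alpha> \<eta> c \<longleftrightarrow> 0 < c \<and> c < 1 \<and>
     (\<forall>p. 0 \<le> p \<and> p < c \<longrightarrow> measure (percolation_measure p) (LIP \<alpha> \<eta>) = 0) \<and>
     (\<forall>p. c < p \<and> p \<le> 1 \<longrightarrow> measure (percolation_measure p) (LIP \<alpha> \<eta>) = 1)"

text \<open>
  The critical probability depends on \<open>\<eta>\<close> only through \<open>k = norm1 \<eta>\<close>, so \<open>p_L\<close> is the number
  that is critical for every such \<open>\<eta>\<close>. It is determined for \<open>0 \<le> \<alpha> < 1\<close> and \<open>k \<le> CARD('d)\<close>.
\<close>

definition p_L :: "('d::finite) itself \<Rightarrow> real \<Rightarrow> nat \<Rightarrow> real" where
  "p_L _ \<alpha> k = (THE c. \<forall>\<eta> :: int ^ 'd. \<eta> \<in> sign_vectors \<and> norm1 \<eta> = int k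
     \<longrightarrow> critical_probability \<alpha> \<eta> c)"

definition q_L :: "('d::finite) itself \<Rightarrow> real \<Rightarrow> nat \<Rightarrow> real" where
  "q_L d \<alpha> k = 1 - p_L d \<alpha> k"

end

theory Submission
  imports Defs
begin

text \<open>
  Let \<open>q = 1 - p\<close>. Call a site reachable if an admissible path leads to it from the region below
  the tilted hyperplane; such a path may climb vertically onto a closed site, and may always move
  to a neighbouring base point while losing one unit of height. An open Lipschitz surface above
  the hyperplane stops all these paths, and conversely, if in every column some site is
  unreachable, the lowest unreachable sites form such a surface (\<open>lipschitz_above_iff\<close>). The
  theorem comes from a first-moment count of admissible paths, made with a potential.

  Put \<open>t = (4d) powr (1 / (1 - \<alpha>))\<close> and \<open>\<Phi>(x, h) = t powr (\<alpha> * norm1 x - h)\<close>. Trace a path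
  backwards from its endpoint. Undoing a climb costs \<open>q\<close>, the probability of a closed site, and
  multiplies \<open>\<Phi>\<close> by \<open>t\<close>; undoing one of the \<open>2d\<close> sideways moves costs nothing and multiplies
  \<open>\<Phi>\<close> by at most \<open>t powr (\<alpha> - 1) = 1 / (4d)\<close>. The total factor of a step is therefore at most
  \<open>\<rho> = q * t + 1 / 2\<close>, and \<open>\<rho> < 1\<close> says precisely that \<open>q < 1 / 2 * (4d) powr (- (1 / (1 - \<alpha>)))\<close>.
  Since \<open>\<Phi> \<ge> 1\<close> below the hyperplane, the site \<open>s\<close> is then reachable with probability at most
  \<open>\<Phi> s / (1 - \<rho>)\<close> (\<open>prob_reachable_le\<close>). This tends to 0 up each column, so almost surely every
  column contains unreachable sites and the surface exists (\<open>prob_lipschitz_above_eq_1\<close>).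

  Because \<open>p_L\<close> is a definite description, the critical probability must also be shown to exist,
  to be unique, and to be the same for all sign vectors without zero entries. The probability of
  the event is 0 or 1 for each \<open>p\<close> (\<open>zero_one_lipschitz_above\<close>) and monotone in \<open>p\<close>
  (\<open>measure_mono_parameter\<close>); it is 0 for \<open>p < 1 / 3\<close>, by counting open Lipschitz paths over a line
  (\<open>prob_lipschitz_above_eq_0\<close>); and reflecting coordinates exchanges the sign vectors
  (\<open>measure_LIP_reflect\<close>).
\<close>

section \<open>The product measure\<close>

interpretation percolation: prob_space "percolation_measure p" for p
  unfolding percolation_measure_def by (intro prob_space_PiM prob_space_measure_pmf)

lemma space_percolation [simp]: "space (percolation_measure p) = UNIV"
  by (simp add: percolation_measure_def space_PiM)

lemma sets_percolation:
  "sets (percolation_measure p :: ('d::finite) config measure)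
     = sets (PiM UNIV (\<lambda>_. count_space UNIV))"
  unfolding percolation_measure_def by (intro sets_PiM_cong) auto

lemma measurable_state [measurable]:
  "(\<lambda>\<omega>. \<omega> s) \<in> measurable (percolation_measure p) (count_space UNIV)"
  unfolding measurable_cong_sets[OF sets_percolation refl] by simp

lemma sets_percolation_Collect:
  assumes "Measurable.pred (percolation_measure p) Q"
  shows "{\<omega>. Q \<omega>} \<in> sets (percolation_measure p)"
  using assms by (simp add: pred_def)

lemma measurable_into_percolation:
  assumes "\<And>s. (\<lambda>x. g x s) \<in> measurable N (count_space UNIV)"
  shows "g \<in> measurable N (percolation_measure p)"
  unfolding measurable_cong_sets[OF refl sets_percolation]
  by (rule measurable_PiM_single') (use assms in auto)

lemma prob_states:
  assumes "finite S" and "0 \<le> p" "p \<le> 1"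
  shows "measure (percolation_measure p) {\<omega>. \<forall>s\<in>S. \<omega> s = v}
           = (if v then p else 1 - p) ^ card S"
proof -
  interpret product_prob_space "\<lambda>_::'a site. measure_pmf (bernoulli_pmf p)" UNIV
    by unfold_locales
  have "emeasure (percolation_measure p) {\<omega>. \<forall>s\<in>S. \<omega> s = v}
          = (\<Prod>s\<in>S. emeasure (measure_pmf (bernoulli_pmf p)) {v})"
    using emeasure_PiM_Collect[of S "\<lambda>_. {v}"] assms
    by (simp add: percolation_measure_def space_PiM)
  also have "\<dots> = ennreal ((if v then p else 1 - p) ^ card S)"
    using assms by (simp add: emeasure_pmf_single ennreal_power)
  finally show ?thesis
    using assms by (simp add: measure_def)
qed

lemma distr_reindex:
  assumes "inj e"
  shows "distr (percolation_measure p) (PiM UNIV (\<lambda>_. measure_pmf (bernoulli_pmf p))) (\<lambda>\<omega> n. \<omega> (e n))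
         = PiM UNIV (\<lambda>_. measure_pmf (bernoulli_pmf p))"
  using distr_PiM_reindex[of UNIV "\<lambda>_. measure_pmf (bernoulli_pmf p)" e UNIV] assms
  by (simp add: percolation_measure_def prob_space_measure_pmf restrict_UNIV)

lemma measure_reindex:
  fixes f :: "'d::finite site \<Rightarrow> 'd site"
  assumes "inj f" and "E \<in> sets (percolation_measure p)"
  shows "measure (percolation_measure p) {\<omega>. \<omega> \<circ> f \<in> E} = measure (percolation_measure p) E"
proof -
  have "measure (percolation_measure p) E
          = measure (distr (percolation_measure p) (percolation_measure p) (\<lambda>\<omega>. \<omega> \<circ> f)) E"
    using distr_reindex[OF assms(1), of p] by (simp add: percolation_measure_def comp_def)
  also have "\<dots> = measure (percolation_measure p) {\<omega>. \<omega> \<circ> f \<in> E}"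
    by (subst measure_distr) (use assms in \<open>auto intro!: measurable_into_percolation simp: vimage_def\<close>)
  finally show ?thesis by simp
qed

lemma indep_states:
  assumes "inj e"
  shows "percolation.indep_vars p (\<lambda>_. measure_pmf (bernoulli_pmf p)) (\<lambda>n \<omega>. \<omega> (e n)) UNIV"
proof (subst percolation.indep_vars_iff_distr_eq_PiM)
  interpret product_prob_space "\<lambda>_::'b site. measure_pmf (bernoulli_pmf p)" UNIV
    by unfold_locales
  show "(\<lambda>\<omega>. \<omega> (e n)) \<in> measurable (percolation_measure p) (measure_pmf (bernoulli_pmf p))" for n
    by simp
  show "distr (percolation_measure p) (PiM UNIV (\<lambda>_. measure_pmf (bernoulli_pmf p))) (\<lambda>\<omega>. \<lambda>n\<in>UNIV. \<omega> (e n))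
      = (\<Pi>\<^sub>M n\<in>UNIV. distr (percolation_measure p) (measure_pmf (bernoulli_pmf p)) (\<lambda>\<omega>. \<omega> (e n)))"
    using distr_reindex[OF assms, of p] PiM_component
    by (simp add: restrict_UNIV percolation_measure_def)
qed simp

text \<open>
  Enumerate the sites. For each \<open>n\<close>, membership in \<open>E\<close> can be decided after opening the first \<open>n\<close>
  sites by force, hence from the remaining ones only; so \<open>E\<close> is a tail event of independent states.
\<close>

lemma zero_one_law:
  fixes E :: "'d::finite config set"
  assumes E: "E \<in> sets (percolation_measure p)"
    and tail: "\<And>\<omega> \<omega>'. \<omega> \<in> E \<Longrightarrow> finite {s. \<omega> s \<noteq> \<omega>' s} \<Longrightarrow> \<omega>' \<in> E"
  shows "measure (percolation_measure p) E = 0 \<or> measure (percolation_measure p) E = 1"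
proof -
  have "infinite (range (\<lambda>n::nat. (0, int n) :: 'd site))"
    by (intro range_inj_infinite) (auto simp: inj_on_def)
  then have "infinite (UNIV :: 'd site set)"
    using finite_subset subset_UNIV by blast
  then obtain e :: "nat \<Rightarrow> 'd site" where e: "bij e"
    using countableE_infinite[OF countableI_type[of "UNIV :: 'd site set"]]
    by (metis bij_betw_inv)
  define A where "A n = {(\<lambda>\<omega>. \<omega> (e n)) -` S \<inter> space (percolation_measure p) |S.
    S \<in> sets (measure_pmf (bernoulli_pmf p))}" for n
  have A_eq: "A n = sets (vimage_algebra UNIV (\<lambda>\<omega>. \<omega> (e n)) (count_space UNIV))" for n
    by (subst sets_vimage_algebra2) (auto simp: A_def)
  have alg: "sigma_algebra (space (percolation_measure p)) (A n)" for n
    unfolding A_eq by (metis sets.sigma_algebra_axioms space_vimage_algebra space_percolation)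
  have indep: "percolation.indep_sets p A UNIV"
    using indep_states[of e p] e unfolding percolation.indep_vars_def2 A_def
    by (simp add: bij_is_inj)
  have "E \<in> percolation.tail_events p A"
    unfolding percolation.tail_events_def
  proof
    fix n
    let ?N = "sigma UNIV (\<Union> (A ` {n..}))"
    define g where "g \<omega> s = (if s \<in> e ` {..<n} then True else \<omega> s)" for \<omega> s
    have setsN: "sets ?N = sigma_sets UNIV (\<Union> (A ` {n..}))"
      by (simp add: sets_measure_of)
    have "g \<in> measurable ?N (percolation_measure p)"
    proof (rule measurable_into_percolation)
      fix s
      obtain m where m: "s = e m" using e by (metis bij_pointE)
      show "(\<lambda>\<omega>. g \<omega> s) \<in> measurable ?N (count_space UNIV)"
      proof (cases "s \<in> e ` {..<n}")
        case True
        then show ?thesis by (simp add: g_def)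
      next
        case False
        then have "m \<ge> n" using m by (meson imageI lessThan_iff not_le)
        then have "(\<lambda>\<omega>. \<omega> s) -` S \<in> sets ?N" for S
          unfolding setsN m by (intro sigma_sets.Basic) (auto simp: A_def)
        then show ?thesis using False by (auto simp: g_def measurable_def)
      qed
    qed
    then have "g -` E \<inter> space ?N \<in> sets ?N"
      using E by (rule measurable_sets)
    moreover have "g -` E = E"
    proof -
      have fin: "finite {s. \<omega> s \<noteq> g \<omega> s}" "finite {s. g \<omega> s \<noteq> \<omega> s}" for \<omega>
        by (rule finite_subset[of _ "e ` {..<n}"]; auto simp: g_def)+
      then show ?thesis using tail by blast
    qed
    ultimately show "E \<in> sigma_sets (space (percolation_measure p)) (\<Union> (A ` {n..}))"
      by (simp add: setsN)
  qed
  from percolation.kolmogorov_0_1_law[OF alg indep this] show ?thesis .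
qed

lemma distr_PiM_map_pmf:
  "distr (PiM UNIV (\<lambda>_. measure_pmf \<kappa>)) (PiM UNIV (\<lambda>_. measure_pmf (map_pmf f \<kappa>))) (\<lambda>\<omega> s. f (\<omega> s))
     = PiM (UNIV :: 'i set) (\<lambda>_. measure_pmf (map_pmf f \<kappa>))"
proof -
  interpret K: product_prob_space "\<lambda>_. measure_pmf \<kappa>" UNIV by unfold_locales
  interpret L: product_prob_space "\<lambda>_. measure_pmf (map_pmf f \<kappa>)" UNIV by unfold_locales
  have meas: "(\<lambda>\<omega> s. f (\<omega> s)) \<in> measurable (PiM UNIV (\<lambda>_. measure_pmf \<kappa>))
      (PiM UNIV (\<lambda>_. measure_pmf (map_pmf f \<kappa>)))"
    by (rule measurable_PiM_single')
      (auto intro!: measurable_compose[OF measurable_component_singleton])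
  show ?thesis
  proof (rule L.PiM_eq)
    fix J :: "'i set" and F assume J: "finite J" "J \<subseteq> UNIV"
    have emb: "prod_emb UNIV (\<lambda>_. measure_pmf (map_pmf f \<kappa>)) J (PiE J F)
        \<in> sets (PiM UNIV (\<lambda>_. measure_pmf (map_pmf f \<kappa>)))"
      using J by (intro sets_PiM_I) auto
    have "emeasure (distr (PiM UNIV (\<lambda>_. measure_pmf \<kappa>)) (PiM UNIV (\<lambda>_. measure_pmf (map_pmf f \<kappa>))) (\<lambda>\<omega> s. f (\<omega> s)))
            (prod_emb UNIV (\<lambda>_. measure_pmf (map_pmf f \<kappa>)) J (PiE J F))
        = emeasure (PiM UNIV (\<lambda>_. measure_pmf \<kappa>))
            (prod_emb UNIV (\<lambda>_. measure_pmf \<kappa>) J (PiE J (\<lambda>j. f -` F j)))"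
      by (subst emeasure_distr[OF meas emb])
        (auto simp: prod_emb_def space_PiM PiE_iff intro!: arg_cong[where f="emeasure _"])
    also have "\<dots> = (\<Prod>j\<in>J. emeasure (measure_pmf \<kappa>) (f -` F j))"
      using J by (intro K.emeasure_PiM_emb) auto
    finally show "emeasure (distr (PiM UNIV (\<lambda>_. measure_pmf \<kappa>)) (PiM UNIV (\<lambda>_. measure_pmf (map_pmf f \<kappa>))) (\<lambda>\<omega> s. f (\<omega> s)))
            (prod_emb UNIV (\<lambda>_. measure_pmf (map_pmf f \<kappa>)) J (PiE J F))
        = (\<Prod>j\<in>J. emeasure (measure_pmf (map_pmf f \<kappa>)) (F j))" by simp
  qed simp
qed

text \<open>
  Coupling: keep each open site of a \<open>p'\<close>-configuration with independent probability \<open>p / p'\<close>.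
  What remains is a \<open>p\<close>-configuration lying below the original one.
\<close>

lemma measure_mono_parameter:
  fixes E :: "'d::finite config set"
  assumes E: "E \<in> sets (percolation_measure p)"
    and up: "\<And>\<omega> \<omega>'. \<omega> \<in> E \<Longrightarrow> (\<And>s. \<omega> s \<Longrightarrow> \<omega>' s) \<Longrightarrow> \<omega>' \<in> E"
    and p: "0 \<le> p" "p \<le> p'" "p' \<le> 1"
  shows "measure (percolation_measure p) E \<le> measure (percolation_measure p') E"
proof (cases "p' = 0")
  case False
  then have p': "p' > 0" using p by simp
  define \<kappa> where "\<kappa> = pair_pmf (bernoulli_pmf p') (bernoulli_pmf (p / p'))"
  let ?Q = "PiM (UNIV :: 'd site set) (\<lambda>_. measure_pmf \<kappa>)"
  let ?both = "\<lambda>(a, b). a \<and> b"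
  interpret Q: prob_space ?Q by (intro prob_space_PiM prob_space_measure_pmf)
  have fst: "map_pmf fst \<kappa> = bernoulli_pmf p'"
    by (simp add: \<kappa>_def map_fst_pair_pmf)
  have True: "pmf (map_pmf ?both \<kappa>) True = p"
  proof -
    have "pmf (map_pmf ?both \<kappa>) True = measure (measure_pmf \<kappa>) {(True, True)}"
      unfolding pmf_map by (rule arg_cong[where f="measure _"]) auto
    also have "\<dots> = p"
      unfolding measure_pmf_single \<kappa>_def pmf_pair using p p' by simp
    finally show ?thesis .
  qed
  have both: "map_pmf ?both \<kappa> = bernoulli_pmf p"
  proof (rule pmf_eqI)
    fix v show "pmf (map_pmf ?both \<kappa>) v = pmf (bernoulli_pmf p) v"
      using True p by (cases v) (simp_all add: pmf_False_conv_True)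
  qed
  have law: "measure (percolation_measure r) E = measure ?Q {\<omega>. (\<lambda>s. f (\<omega> s)) \<in> E}"
    and meas: "{\<omega>. (\<lambda>s. f (\<omega> s)) \<in> E} \<in> sets ?Q"
    if "map_pmf f \<kappa> = bernoulli_pmf r" for f r
  proof -
    have M: "(\<lambda>\<omega> s. f (\<omega> s)) \<in> measurable ?Q (percolation_measure r)"
      by (rule measurable_into_percolation)
        (auto intro!: measurable_compose[OF measurable_component_singleton])
    have Er: "E \<in> sets (percolation_measure r)" using E by (simp add: sets_percolation)
    have "percolation_measure r = distr ?Q (percolation_measure r) (\<lambda>\<omega> s. f (\<omega> s))"
      unfolding percolation_measure_def by (rule distr_PiM_map_pmf[of \<kappa> f, unfolded that, symmetric])
    then have "measure (percolation_measure r) E = measure (distr ?Q (percolation_measure r) (\<lambda>\<omega> s. f (\<omega> s))) E"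
      by simp
    also have "\<dots> = measure ?Q {\<omega>. (\<lambda>s. f (\<omega> s)) \<in> E}"
      by (subst measure_distr[OF M Er]) (simp add: vimage_def space_PiM)
    finally show "measure (percolation_measure r) E = measure ?Q {\<omega>. (\<lambda>s. f (\<omega> s)) \<in> E}" .
    show "{\<omega>. (\<lambda>s. f (\<omega> s)) \<in> E} \<in> sets ?Q"
      using measurable_sets[OF M Er] by (simp add: vimage_def space_PiM)
  qed
  show ?thesis
    unfolding law[OF fst] law[OF both]
    by (rule Q.finite_measure_mono[OF _ meas[OF fst]]) (auto elim!: up simp: case_prod_beta)
qed (use p in auto)

section \<open>Lipschitz surfaces and admissible paths\<close>

text \<open>
  The tilted hyperplane is replaced by an arbitrary lower bound \<open>b\<close>, so that vertical translates
  of the event, which the zero-one law needs, have the same form.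
\<close>

definition lipschitz_above :: "(int ^ 'd::finite \<Rightarrow> int) \<Rightarrow> 'd config set" where
  "lipschitz_above b = {\<omega>. \<exists>F. lipschitz_fun F \<and> (\<forall>x. \<omega> (x, F x) \<and> F x > b x)}"

lemma norm1_minus: "norm1 (- x) = norm1 x"
  by (simp add: norm1_def)

lemma norm1_triangle: "norm1 (x + y) \<le> norm1 x + norm1 y"
  unfolding norm1_def sum.distrib[symmetric] by (intro sum_mono) auto

text \<open>
  The possible predecessors of a site on an admissible path. Paths are stored backwards, with their
  endpoint at the head of the list, because both the construction of longer paths and the count of
  paths to a given site proceed from the endpoint.
\<close>

definition back_steps :: "'d::finite site \<Rightarrow> 'd site set" where
  "back_steps s = insert (fst s, snd s - 1) ((\<lambda>u. (fst s - u, snd s + 1)) ` {u. norm1 u = 1})"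

definition admissible :: "'d::finite config \<Rightarrow> 'd site list \<Rightarrow> bool" where
  "admissible \<omega> = successively (\<lambda>s t. t \<in> back_steps s \<and> (snd t < snd s \<longrightarrow> \<not> \<omega> s))"

definition starts_below :: "(int ^ 'd::finite \<Rightarrow> int) \<Rightarrow> 'd site list \<Rightarrow> bool" where
  "starts_below b w \<longleftrightarrow> snd (last w) \<le> b (fst (last w))"

definition reachable :: "'d::finite config \<Rightarrow> (int ^ 'd \<Rightarrow> int) \<Rightarrow> 'd site \<Rightarrow> bool" where
  "reachable \<omega> b s \<longleftrightarrow> (\<exists>w. w \<noteq> [] \<and> hd w = s \<and> starts_below b w \<and> admissible \<omega> w)"

lemma reachable_base: "h \<le> b x \<Longrightarrow> reachable \<omega> b (x, h)"
  unfolding reachable_def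
  by (rule exI[of _ "[(x, h)]"]) (simp add: admissible_def starts_below_def)

lemma reachable_step:
  assumes "reachable \<omega> b t" "t \<in> back_steps s" "snd t < snd s \<longrightarrow> \<not> \<omega> s"
  shows "reachable \<omega> b s"
proof -
  obtain w where "w \<noteq> []" "hd w = t" "starts_below b w" "admissible \<omega> w"
    using assms(1) by (auto simp: reachable_def)
  then show ?thesis
    unfolding reachable_def using assms(2,3)
    by (intro exI[of _ "s # w"]) (auto simp: admissible_def successively_Cons starts_below_def)
qed

lemma reachable_up: "reachable \<omega> b (x, h) \<Longrightarrow> \<not> \<omega> (x, h + 1) \<Longrightarrow> reachable \<omega> b (x, h + 1)"
  by (erule reachable_step) (auto simp: back_steps_def)

lemma reachable_down:
  assumes "reachable \<omega> b (x, h)" "norm1 (y - x) = 1"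
  shows "reachable \<omega> b (y, h - 1)"
proof -
  have "(x, h) \<in> back_steps (y, h - 1)"
    unfolding back_steps_def using assms(2) by (auto intro!: image_eqI[of _ _ "y - x"])
  from reachable_step[OF assms(1) this] show ?thesis by simp
qed

text \<open>
  A path cannot cross the surface: a climb would have to enter an open site, and a sideways move
  loses the one unit of height by which the surface may drop.
\<close>

lemma reachable_below_open_surface:
  assumes lip: "lipschitz_fun F" and above: "\<And>x. \<omega> (x, F x) \<and> F x > b x"
    and "reachable \<omega> b s"
  shows "snd s < F (fst s)"
proof -
  have "snd (hd w) < F (fst (hd w))" if "w \<noteq> []" "starts_below b w" "admissible \<omega> w" for w
    using that
  proof (induction w)
    case (Cons s w)
    show ?case
    proof (cases "w = []")
      case True
      then show ?thesis using Cons.prems above[of "fst s"] by (simp add: starts_below_def)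
    next
      case False
      then have IH: "snd (hd w) < F (fst (hd w))"
        and step: "hd w \<in> back_steps s" "snd (hd w) < snd s \<longrightarrow> \<not> \<omega> s"
        using Cons by (auto simp: admissible_def successively_Cons starts_below_def)
      from step(1) consider "hd w = (fst s, snd s - 1)"
        | u where "norm1 u = 1" "hd w = (fst s - u, snd s + 1)"
        by (auto simp: back_steps_def)
      then show ?thesis
      proof cases
        case 1
        then have "\<not> \<omega> s" "snd s \<le> F (fst s)" using step IH by auto
        moreover have "snd s \<noteq> F (fst s)"
          using above[of "fst s"] \<open>\<not> \<omega> s\<close> by (metis prod.collapse)
        ultimately show ?thesis by simp
      next
        case 2
        then have "\<bar>F (fst s) - F (fst s - u)\<bar> \<le> 1"
          using lip by (simp add: lipschitz_fun_def)
        then show ?thesis using 2 IH by simp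
      qed
    qed
  qed simp
  then show ?thesis using assms(3) by (auto simp: reachable_def)
qed

text \<open>
  For the converse, take the lowest unreachable site of each column. It is open, since the site below
  it is reachable and would otherwise allow a climb; and it lies at most one unit above the
  neighbouring ones, since a reachable site makes its neighbours one unit lower reachable. This also
  turns the existence of a function into a countable condition, and so makes the event measurable.
\<close>

lemma lipschitz_above_iff:
  "\<omega> \<in> lipschitz_above b \<longleftrightarrow> (\<forall>x. \<exists>n. \<not> reachable \<omega> b (x, n))"
proof
  assume "\<omega> \<in> lipschitz_above b"
  then obtain F where "lipschitz_fun F" "\<And>x. \<omega> (x, F x) \<and> F x > b x"
    by (auto simp: lipschitz_above_def)
  from reachable_below_open_surface[OF this] show "\<forall>x. \<exists>n. \<not> reachable \<omega> b (x, n)"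
    by fastforce
next
  assume escape: "\<forall>x. \<exists>n. \<not> reachable \<omega> b (x, n)"
  define m where "m x = (LEAST k. \<not> reachable \<omega> b (x, b x + 1 + int k))" for x
  define F where "F x = b x + 1 + int (m x)" for x
  have F_unreachable: "\<not> reachable \<omega> b (x, F x)" for x
  proof -
    obtain n where n: "\<not> reachable \<omega> b (x, n)" using escape by blast
    with reachable_base[of n b x \<omega>] have "n > b x" by force
    then have "\<not> reachable \<omega> b (x, b x + 1 + int (nat (n - b x - 1)))" using n by simp
    from LeastI[of "\<lambda>k. \<not> reachable \<omega> b (x, b x + 1 + int k)", OF this]
    show ?thesis by (simp add: F_def m_def)
  qed
  have F_minimal: "reachable \<omega> b (x, h)" if "h < F x" for x h
  proof (cases "h \<le> b x")
    case False
    then have "nat (h - b x - 1) < m x" using that by (simp add: F_def)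
    from not_less_Least[OF this[unfolded m_def]] show ?thesis using False by simp
  qed (rule reachable_base)
  have "\<omega> (x, F x)" for x
    using reachable_up[OF F_minimal[of "F x - 1" x]] F_unreachable[of x] by auto
  moreover have "F x > b x" for x by (simp add: F_def)
  moreover have "lipschitz_fun F"
  proof -
    have "F x \<le> F y + 1" if "norm1 (y - x) = 1" for x y
    proof (rule ccontr)
      assume "\<not> ?thesis"
      then have "reachable \<omega> b (x, F y + 1)" by (intro F_minimal) simp
      from reachable_down[OF this that] F_unreachable[of y] show False by simp
    qed
    then show ?thesis
      unfolding lipschitz_fun_def by (smt (verit) minus_diff_eq norm1_minus)
  qed
  ultimately show "\<omega> \<in> lipschitz_above b"
    unfolding lipschitz_above_def by blast
qed

lemma measurable_admissible [measurable]:
  "Measurable.pred (percolation_measure p) (\<lambda>\<omega>. admissible \<omega> w)"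
  unfolding admissible_def
proof (induction w)
  case (Cons s w)
  then show ?case unfolding successively_Cons by measurable
qed simp

lemma measurable_reachable [measurable]:
  "Measurable.pred (percolation_measure p) (\<lambda>\<omega>. reachable \<omega> b s)"
  unfolding reachable_def by measurable

lemma lipschitz_above_sets: "lipschitz_above b \<in> sets (percolation_measure p)"
proof -
  have "lipschitz_above b = {\<omega>. \<forall>x. \<exists>n. \<not> reachable \<omega> b (x, n)}"
    using lipschitz_above_iff by auto
  also have "\<dots> \<in> sets (percolation_measure p)"
    by (rule sets_percolation_Collect) measurable
  finally show ?thesis .
qed

lemma lipschitz_above_increasing:
  "\<omega> \<in> lipschitz_above b \<Longrightarrow> (\<And>s. \<omega> s \<Longrightarrow> \<omega>' s) \<Longrightarrow> \<omega>' \<in> lipschitz_above b"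
  unfolding lipschitz_above_def by blast

lemma lipschitz_above_antimono:
  "(\<And>x. b' x \<le> b x) \<Longrightarrow> lipschitz_above b \<subseteq> lipschitz_above b'"
  unfolding lipschitz_above_def by (blast intro: le_less_trans)

lemma measure_lipschitz_above_shift:
  "measure (percolation_measure p) (lipschitz_above (\<lambda>x. b x + K))
     = measure (percolation_measure p) (lipschitz_above b)"
proof -
  define f :: "'a site \<Rightarrow> 'a site" where "f = (\<lambda>(x, h). (x, h + K))"
  have "{\<omega>. \<omega> \<circ> f \<in> lipschitz_above b} = lipschitz_above (\<lambda>x. b x + K)"
  proof safe
    fix \<omega> assume "\<omega> \<circ> f \<in> lipschitz_above b"
    then obtain F where "lipschitz_fun F" "\<forall>x. (\<omega> \<circ> f) (x, F x) \<and> F x > b x"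
      by (auto simp: lipschitz_above_def)
    then show "\<omega> \<in> lipschitz_above (\<lambda>x. b x + K)"
      unfolding lipschitz_above_def
      by (intro CollectI exI[of _ "\<lambda>x. F x + K"]) (auto simp: f_def lipschitz_fun_def)
  next
    fix \<omega> assume "\<omega> \<in> lipschitz_above (\<lambda>x. b x + K)"
    then obtain F where "lipschitz_fun F" "\<forall>x. \<omega> (x, F x) \<and> F x > b x + K"
      by (auto simp: lipschitz_above_def)
    then show "\<omega> \<circ> f \<in> lipschitz_above b"
      unfolding lipschitz_above_def
      by (intro CollectI exI[of _ "\<lambda>x. F x - K"])
        (auto simp: f_def lipschitz_fun_def algebra_simps)
  qed
  moreover have "inj f" by (auto simp: f_def inj_on_def)
  ultimately show ?thesis
    using measure_reindex[OF _ lipschitz_above_sets, of f p b] by simp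
qed

text \<open>
  Closing a single site can destroy the only surface above \<open>b\<close>, but the existence of surfaces above
  every translate of \<open>b\<close> is insensitive to finite changes: choose the translate so high that the surface passes over all
  modified sites.
\<close>

lemma lipschitz_above_all_heights_tail:
  assumes \<omega>: "\<omega> \<in> (\<Inter>K::nat. lipschitz_above (\<lambda>x. b x + int K))"
    and fin: "finite {s. \<omega> s \<noteq> \<omega>' s}"
  shows "\<omega>' \<in> (\<Inter>K::nat. lipschitz_above (\<lambda>x. b x + int K))"
proof
  fix K :: nat
  \<comment> \<open>heights above \<open>b\<close> of the modified sites\<close>
  define D where "D = (\<lambda>(x, h). h - b x) ` {s. \<omega> s \<noteq> \<omega>' s}"
  have "finite D" using fin by (simp add: D_def)
  define L where "L = max K (nat (Max (insert 0 D)))"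
  have L: "h \<le> b x + int L" if "\<omega> (x, h) \<noteq> \<omega>' (x, h)" for x h
  proof -
    have "h - b x \<in> insert 0 D" using that by (force simp: D_def)
    then have "h - b x \<le> Max (insert 0 D)" using \<open>finite D\<close> by (intro Max_ge) auto
    then show ?thesis by (auto simp: L_def)
  qed
  obtain F where F: "lipschitz_fun F" "\<And>x. \<omega> (x, F x)" "\<And>x. F x > b x + int L"
    using \<omega> by (force simp: lipschitz_above_def)
  have "\<omega>' (x, F x)" for x using F(2,3)[of x] L[of x "F x"] by auto
  moreover have "F x > b x + int K" for x using F(3)[of x] by (simp add: L_def)
  ultimately show "\<omega>' \<in> lipschitz_above (\<lambda>x. b x + int K)"
    using F(1) by (auto simp: lipschitz_above_def)
qed

text \<open>
  The events for the translates of \<open>b\<close> decrease and all have the same probability, so each has the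
  probability of their intersection, to which the zero-one law applies.
\<close>

lemma zero_one_lipschitz_above:
  "measure (percolation_measure p) (lipschitz_above b) = 0
     \<or> measure (percolation_measure p) (lipschitz_above b) = 1"
proof -
  let ?E = "\<lambda>K::nat. lipschitz_above (\<lambda>x. b x + int K)"
  have "decseq ?E"
    by (intro decseq_SucI lipschitz_above_antimono) simp
  then have "(\<lambda>K. measure (percolation_measure p) (?E K)) \<longlonglongrightarrow> measure (percolation_measure p) (\<Inter>K. ?E K)"
    by (intro percolation.finite_Lim_measure_decseq) (auto intro: lipschitz_above_sets)
  then have "measure (percolation_measure p) (lipschitz_above b) = measure (percolation_measure p) (\<Inter>K. ?E K)"
    by (simp add: measure_lipschitz_above_shift LIMSEQ_const_iff)
  moreover
  have "(\<Inter>K. ?E K) \<in> sets (percolation_measure p)"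
    by (intro sets.countable_INT) (auto intro: lipschitz_above_sets)
  then have "measure (percolation_measure p) (\<Inter>K. ?E K) = 0 \<or> measure (percolation_measure p) (\<Inter>K. ?E K) = 1"
    by (rule zero_one_law) (rule lipschitz_above_all_heights_tail)
  ultimately show ?thesis by simp
qed

section \<open>First-moment bounds for walks\<close>

lemma norm1_eq_1_cases:
  assumes "norm1 (u :: int ^ 'd::finite) = 1"
  obtains i v where "u = axis i v" "v = 1 \<or> v = -1"
proof -
  have "\<exists>i. u $ i \<noteq> 0"
  proof (rule ccontr)
    assume "\<nexists>i. u $ i \<noteq> 0"
    then show False using assms by (simp add: norm1_def)
  qed
  then obtain i where i: "u $ i \<noteq> 0" by blast
  have split: "norm1 u = \<bar>u $ i\<bar> + (\<Sum>j\<in>UNIV - {i}. \<bar>u $ j\<bar>)"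
    unfolding norm1_def by (rule sum.remove) auto
  have rest: "(\<Sum>j\<in>UNIV - {i}. \<bar>u $ j\<bar>) \<ge> 0" by (rule sum_nonneg) simp
  then have "\<bar>u $ i\<bar> = 1" and "(\<Sum>j\<in>UNIV - {i}. \<bar>u $ j\<bar>) = 0"
    using split assms i by linarith+
  then have "\<forall>j\<in>UNIV - {i}. u $ j = 0"
    by (subst (asm) sum_nonneg_eq_0_iff) auto
  then have "u = axis i (u $ i)" by (auto simp: vec_eq_iff axis_def)
  moreover have "u $ i = 1 \<or> u $ i = -1" using \<open>\<bar>u $ i\<bar> = 1\<close> by linarith
  ultimately show ?thesis using that by blast
qed

lemma unit_steps:
  shows finite_unit_steps: "finite {u :: int ^ 'd::finite. norm1 u = 1}"
    and card_unit_steps: "card {u :: int ^ 'd::finite. norm1 u = 1} \<le> 2 * CARD('d)"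
proof -
  let ?T = "UNIV \<times> {1, -1} :: ('d \<times> int) set"
  have sub: "{u :: int ^ 'd. norm1 u = 1} \<subseteq> (\<lambda>(i, v). axis i v) ` ?T"
    by (auto elim!: norm1_eq_1_cases)
  then show "finite {u :: int ^ 'd. norm1 u = 1}" by (rule finite_subset) simp
  have "card {u :: int ^ 'd. norm1 u = 1} \<le> card ((\<lambda>(i, v). axis i v :: int ^ 'd) ` ?T)"
    using sub by (rule card_mono[rotated]) simp
  also have "\<dots> \<le> card ?T" by (rule card_image_le) simp
  also have "\<dots> = 2 * CARD('d)" by (simp add: card_cartesian_product)
  finally show "card {u :: int ^ 'd. norm1 u = 1} \<le> 2 * CARD('d)" .
qed

definition walks :: "('a \<Rightarrow> 'a set) \<Rightarrow> nat \<Rightarrow> 'a \<Rightarrow> 'a list set" where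
  "walks succs k s = {w. length w = Suc k \<and> hd w = s \<and> successively (\<lambda>s t. t \<in> succs s) w}"

fun walk_weight :: "('a \<Rightarrow> 'a \<Rightarrow> real) \<Rightarrow> 'a list \<Rightarrow> real" where
  "walk_weight c (s # t # w) = c s t * walk_weight c (t # w)"
| "walk_weight c _ = 1"

lemma walks_0: "walks succs 0 s = {[s]}"
  by (auto simp: walks_def length_Suc_conv)

lemma walks_Suc: "walks succs (Suc k) s = (\<Union>t\<in>succs s. Cons s ` walks succs k t)"
  by (auto simp: walks_def length_Suc_conv successively_Cons)

lemma finite_walks: "(\<And>s. finite (succs s)) \<Longrightarrow> finite (walks succs k s)"
  by (induction k arbitrary: s) (auto simp: walks_0 walks_Suc)

lemma walk_weight_nonneg: "(\<And>s t. c s t \<ge> 0) \<Longrightarrow> walk_weight c w \<ge> 0"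
  by (induction c w rule: walk_weight.induct) auto

lemma walk_weight_Cons:
  "w \<in> walks succs k t \<Longrightarrow> walk_weight c (s # w) = c s t * walk_weight c w"
  by (auto simp: walks_def length_Suc_conv)

text \<open>
  The sum over walks is the \<open>k\<close>-fold application to \<open>\<Phi>\<close> of the transfer operator with kernel \<open>c\<close>,
  and each application gains a factor \<open>\<rho>\<close>.
\<close>

lemma first_moment:
  assumes fin: "\<And>s. finite (succs s)" and c: "\<And>s t. c s t \<ge> 0" and \<rho>: "\<rho> \<ge> 0"
    and superharmonic: "\<And>s. (\<Sum>t\<in>succs s. c s t * \<Phi> t) \<le> \<rho> * \<Phi> s"
  shows "(\<Sum>w\<in>walks succs k s. walk_weight c w * \<Phi> (last w)) \<le> \<rho> ^ k * \<Phi> s"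
proof (induction k arbitrary: s)
  case (Suc k)
  have "(\<Sum>w\<in>walks succs (Suc k) s. walk_weight c w * \<Phi> (last w))
      = (\<Sum>t\<in>succs s. \<Sum>w\<in>Cons s ` walks succs k t. walk_weight c w * \<Phi> (last w))"
    unfolding walks_Suc
    by (rule sum.UNION_disjoint) (auto simp: fin finite_walks, auto simp: walks_def)
  also have "\<dots> = (\<Sum>t\<in>succs s. c s t * (\<Sum>w\<in>walks succs k t. walk_weight c w * \<Phi> (last w)))"
  proof (rule sum.cong[OF refl])
    fix t
    have "(\<Sum>w\<in>Cons s ` walks succs k t. walk_weight c w * \<Phi> (last w))
        = (\<Sum>w\<in>walks succs k t. walk_weight c (s # w) * \<Phi> (last (s # w)))"
      by (subst sum.reindex) auto
    also have "\<dots> = (\<Sum>w\<in>walks succs k t. c s t * (walk_weight c w * \<Phi> (last w)))"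
      by (rule sum.cong) (auto simp: walk_weight_Cons, auto simp: walks_def)
    finally show "(\<Sum>w\<in>Cons s ` walks succs k t. walk_weight c w * \<Phi> (last w))
        = c s t * (\<Sum>w\<in>walks succs k t. walk_weight c w * \<Phi> (last w))"
      by (simp add: sum_distrib_left)
  qed
  also have "\<dots> \<le> (\<Sum>t\<in>succs s. c s t * (\<rho> ^ k * \<Phi> t))"
    by (intro sum_mono mult_left_mono Suc c)
  also have "\<dots> = \<rho> ^ k * (\<Sum>t\<in>succs s. c s t * \<Phi> t)"
    by (simp add: sum_distrib_left mult_ac)
  also have "\<dots> \<le> \<rho> ^ k * (\<rho> * \<Phi> s)"
    by (intro mult_left_mono superharmonic zero_le_power \<rho>)
  finally show ?case by (simp add: mult_ac)
qed (simp add: walks_0)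

section \<open>Upper bound for reachability\<close>

definition climb_cost :: "real \<Rightarrow> 'd site \<Rightarrow> 'd site \<Rightarrow> real" where
  "climb_cost q s t = (if snd t < snd s then q else 1)"

text \<open>
  On a path without repetitions the climbs end at distinct sites, all of which must be closed.
\<close>

lemma prob_admissible_le:
  assumes "distinct w" and p: "0 \<le> p" "p \<le> 1"
  shows "measure (percolation_measure p) {\<omega>. admissible \<omega> w} \<le> walk_weight (climb_cost (1 - p)) w"
proof -
  \<comment> \<open>\<open>U\<close> is the set of sites that the path climbs onto.\<close>
  have "\<exists>U. U \<subseteq> set w \<and> (1 - p) ^ card U = walk_weight (climb_cost (1 - p)) w \<and>
            (\<forall>\<omega>. admissible \<omega> w \<longrightarrow> (\<forall>s\<in>U. \<not> \<omega> s))"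
    using \<open>distinct w\<close>
  proof (induction "climb_cost (1 - p) :: 'a site \<Rightarrow> _" w rule: walk_weight.induct)
    case (1 s t w)
    then obtain U where U: "U \<subseteq> set (t # w)"
      "(1 - p) ^ card U = walk_weight (climb_cost (1 - p)) (t # w)"
      "\<And>\<omega> s. admissible \<omega> (t # w) \<Longrightarrow> s \<in> U \<Longrightarrow> \<not> \<omega> s" by auto
    have "finite U" "s \<notin> U" using U(1) 1(2) finite_subset by auto
    then show ?case
      by (intro exI[of _ "if snd t < snd s then insert s U else U"])
        (use U in \<open>auto simp: climb_cost_def admissible_def\<close>)
  qed (auto intro!: exI[of _ "{}"])
  then obtain U where U: "U \<subseteq> set w" "(1 - p) ^ card U = walk_weight (climb_cost (1 - p)) w"
    "\<And>\<omega> s. admissible \<omega> w \<Longrightarrow> s \<in> U \<Longrightarrow> \<not> \<omega> s" by blast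
  have "{\<omega>. \<forall>s\<in>U. \<omega> s = False} \<in> sets (percolation_measure p)"
    by (rule sets_percolation_Collect) measurable
  then have "measure (percolation_measure p) {\<omega>. admissible \<omega> w}
      \<le> measure (percolation_measure p) {\<omega>. \<forall>s\<in>U. \<omega> s = False}"
    by (rule percolation.finite_measure_mono[rotated]) (use U(3) in auto)
  also have "\<dots> = walk_weight (climb_cost (1 - p)) w"
    using prob_states[of U p False] U(1,2) p finite_subset by fastforce
  finally show ?thesis .
qed

text \<open>
  Loops can be cut out of an admissible path.
\<close>

lemma reachable_distinct:
  assumes "reachable \<omega> b s"
  obtains w where "w \<noteq> []" "hd w = s" "starts_below b w" "admissible \<omega> w" "distinct w"
proof -
  have "\<exists>v. v \<noteq> [] \<and> hd v = hd w \<and> last v = last w \<and> admissible \<omega> v \<and> distinct v"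
    if "w \<noteq> []" "admissible \<omega> w" for w
    using that
  proof (induction w)
    case (Cons s w)
    show ?case
    proof (cases "w = []")
      case False
      then obtain v where v: "v \<noteq> []" "hd v = hd w" "last v = last w" "admissible \<omega> v" "distinct v"
        using Cons by (auto simp: admissible_def successively_Cons)
      show ?thesis
      proof (cases "s \<in> set v")
        case True
        then obtain v1 v2 where "v = v1 @ s # v2" by (meson split_list)
        then show ?thesis using v False
          by (intro exI[of _ "s # v2"]) (auto simp: admissible_def successively_append_iff)
      next
        case False
        then show ?thesis using v \<open>w \<noteq> []\<close> Cons.prems
          by (intro exI[of _ "s # v"]) (auto simp: admissible_def successively_Cons)
      qed
    qed (auto intro!: exI[of _ "[s]"] simp: admissible_def)
  qed simp
  then show ?thesis using assms that unfolding reachable_def starts_below_def by metis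
qed

lemma finite_back_steps: "finite (back_steps s)"
  by (simp add: back_steps_def finite_unit_steps)

text \<open>
  A reachable site is the endpoint of an admissible path without repetitions. On its other end
  \<open>\<Phi>\<close> is at least 1, so weighting by \<open>\<Phi>\<close> there only increases the expected number of such paths;
  the first-moment bounds for the lengths \<open>k\<close> then sum to a geometric series.
\<close>

lemma prob_reachable_le:
  fixes b :: "int ^ 'd::finite \<Rightarrow> int"
  assumes p: "0 \<le> p" "p \<le> 1" and \<rho>: "0 \<le> \<rho>" "\<rho> < 1"
    and nonneg: "\<And>s. \<Phi> s \<ge> 0"
    and ground: "\<And>x h. h \<le> b x \<Longrightarrow> \<Phi> (x, h) \<ge> 1"
    and superharmonic: "\<And>s. (\<Sum>t\<in>back_steps s. climb_cost (1 - p) s t * \<Phi> t) \<le> \<rho> * \<Phi> s"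
  shows "measure (percolation_measure p) {\<omega>. reachable \<omega> b s} \<le> \<Phi> s / (1 - \<rho>)"
proof -
  let ?P = "percolation_measure p"
  have cost: "climb_cost (1 - p) s t \<ge> 0" for s t :: "'d site"
    using p by (simp add: climb_cost_def)
  \<comment> \<open>Only walks without repetitions are counted, but the sum is then extended to all walks.\<close>
  define V where "V k = {w \<in> walks back_steps k s. distinct w \<and> starts_below b w}" for k
  have finV: "finite (V k)" for k
    by (rule finite_subset[OF _ finite_walks[of back_steps k s]]) (auto simp: V_def finite_back_steps)
  define B where "B k = (\<Union>w\<in>V k. {\<omega>. admissible \<omega> w})" for k
  have adm_sets: "{\<omega>. admissible \<omega> w} \<in> sets ?P" for w :: "'d site list"
    by (rule sets_percolation_Collect) (rule measurable_admissible)
  have B_sets: "B k \<in> sets ?P" for k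
    unfolding B_def using finV adm_sets by (intro sets.finite_UN) auto
  have B_le: "measure ?P (B k) \<le> \<rho> ^ k * \<Phi> s" for k
  proof -
    have "measure ?P (B k) \<le> (\<Sum>w\<in>V k. measure ?P {\<omega>. admissible \<omega> w})"
      unfolding B_def using finV adm_sets
      by (intro percolation.finite_measure_subadditive_finite) auto
    also have "\<dots> \<le> (\<Sum>w\<in>V k. walk_weight (climb_cost (1 - p)) w * \<Phi> (last w))"
    proof (rule sum_mono)
      fix w assume w: "w \<in> V k"
      have "measure ?P {\<omega>. admissible \<omega> w} \<le> walk_weight (climb_cost (1 - p)) w"
        using w p by (intro prob_admissible_le) (auto simp: V_def)
      also have "\<dots> \<le> walk_weight (climb_cost (1 - p)) w * \<Phi> (last w)"
      proof -
        have "\<Phi> (last w) \<ge> 1"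
          using ground[of "snd (last w)" "fst (last w)"] w by (simp add: V_def starts_below_def)
        moreover have "walk_weight (climb_cost (1 - p)) w \<ge> 0"
          by (rule walk_weight_nonneg) (rule cost)
        ultimately show ?thesis by (simp add: mult_le_cancel_left1)
      qed
      finally show "measure ?P {\<omega>. admissible \<omega> w} \<le> walk_weight (climb_cost (1 - p)) w * \<Phi> (last w)" .
    qed
    also have "\<dots> \<le> (\<Sum>w\<in>walks back_steps k s. walk_weight (climb_cost (1 - p)) w * \<Phi> (last w))"
      by (intro sum_mono2 finite_walks finite_back_steps)
        (auto simp: V_def intro!: mult_nonneg_nonneg walk_weight_nonneg cost nonneg)
    also have "\<dots> \<le> \<rho> ^ k * \<Phi> s"
      by (intro first_moment finite_back_steps cost superharmonic \<rho>)
    finally show ?thesis .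
  qed
  have geom: "(\<lambda>k. \<rho> ^ k * \<Phi> s) sums (1 / (1 - \<rho>) * \<Phi> s)"
    using \<rho> by (intro sums_mult2 geometric_sums) auto
  have summ: "summable (\<lambda>k. measure ?P (B k))"
    by (rule summable_comparison_test'[OF sums_summable[OF geom]]) (use B_le in auto)
  have "{\<omega>. reachable \<omega> b s} \<subseteq> (\<Union>k. B k)"
  proof clarify
    fix \<omega> assume "reachable \<omega> b s"
    then obtain w where w: "w \<noteq> []" "hd w = s" "starts_below b w" "admissible \<omega> w" "distinct w"
      by (rule reachable_distinct)
    then have "w \<in> V (length w - 1)"
      by (auto simp: V_def walks_def admissible_def elim: successively_mono)
    then show "\<omega> \<in> (\<Union>k. B k)" using w by (auto simp: B_def)
  qed
  then have "measure ?P {\<omega>. reachable \<omega> b s} \<le> measure ?P (\<Union>k. B k)"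
    using B_sets by (intro percolation.finite_measure_mono) auto
  also have "\<dots> \<le> (\<Sum>k. measure ?P (B k))"
    using B_sets summ by (intro percolation.finite_measure_subadditive_countably) auto
  also have "\<dots> \<le> (\<Sum>k. \<rho> ^ k * \<Phi> s)"
    using B_le summ sums_summable[OF geom] by (intro suminf_le)
  also have "\<dots> = \<Phi> s / (1 - \<rho>)"
    using sums_unique[OF geom] by simp
  finally show ?thesis .
qed

section \<open>Surfaces exist almost surely for few closed sites\<close>

text \<open>
  The exponent \<open>\<alpha> * norm1 x - h\<close> is how far the site \<open>(x, h)\<close> lies below the cone of slope \<open>\<alpha>\<close>,
  which dominates the tilted hyperplanes. A backward climb raises it by 1 and a backward sideways move lowers it by at least
  \<open>1 - \<alpha>\<close>; \<open>t\<close> is chosen so that the \<open>2d\<close> sideways moves together contribute \<open>1 / 2\<close>.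
\<close>

lemma superharmonic_potential:
  fixes \<alpha> q t :: real and s :: "'d::finite site"
  defines "\<Phi> \<equiv> \<lambda>s :: 'd site. t powr (\<alpha> * norm1 (fst s) - snd s)"
  assumes \<alpha>: "0 \<le> \<alpha>" and t: "t \<ge> 1" "t powr (\<alpha> - 1) = 1 / (4 * CARD('d))"
  shows "(\<Sum>r\<in>back_steps s. climb_cost q s r * \<Phi> r) \<le> (q * t + 1 / 2) * \<Phi> s"
proof -
  obtain x h where s: "s = (x, h)" by (cases s)
  let ?U = "{u :: int ^ 'd. norm1 u = 1}"
  have t_pos: "t > 0" using t by simp
  have climb: "\<Phi> (x, h - 1) = t * \<Phi> s"
  proof -
    have "\<alpha> * norm1 x - (h - 1) = 1 + (\<alpha> * norm1 x - h)" by simp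
    then show ?thesis
      using t_pos unfolding \<Phi>_def s by (simp only: fst_conv snd_conv powr_add) simp
  qed
  have side: "\<Phi> (x - u, h + 1) \<le> \<Phi> s * (1 / (4 * CARD('d)))" if "u \<in> ?U" for u
  proof -
    have "norm1 (x - u) \<le> norm1 x + 1"
      using norm1_triangle[of x "- u"] that by (simp add: norm1_minus)
    then have "\<alpha> * norm1 (x - u) \<le> \<alpha> * (norm1 x + 1)"
      using \<alpha> by (intro mult_left_mono) linarith+
    then have "\<Phi> (x - u, h + 1) \<le> t powr ((\<alpha> * norm1 x - h) + (\<alpha> - 1))"
      unfolding \<Phi>_def using t by (intro powr_mono) (auto simp: algebra_simps)
    also have "\<dots> = \<Phi> s * (1 / (4 * CARD('d)))"
      by (simp only: powr_add t \<Phi>_def s fst_conv snd_conv)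
    finally show ?thesis .
  qed
  have "(\<Sum>u\<in>?U. \<Phi> (x - u, h + 1)) \<le> card ?U * (\<Phi> s * (1 / (4 * CARD('d))))"
    by (rule sum_bounded_above) (rule side)
  also have "\<dots> \<le> (2 * CARD('d)) * (\<Phi> s * (1 / (4 * CARD('d))))"
    using card_unit_steps[where 'd='d]
    by (intro mult_right_mono) (auto simp: \<Phi>_def simp flip: of_nat_mult)
  also have "\<dots> = \<Phi> s / 2" by simp
  finally have sides: "(\<Sum>u\<in>?U. \<Phi> (x - u, h + 1)) \<le> \<Phi> s / 2" .
  have "(\<Sum>r\<in>back_steps s. climb_cost q s r * \<Phi> r)
      = q * \<Phi> (x, h - 1) + (\<Sum>r\<in>(\<lambda>u. (x - u, h + 1)) ` ?U. climb_cost q s r * \<Phi> r)"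
    unfolding back_steps_def s
    by (subst sum.insert) (auto simp: finite_unit_steps climb_cost_def)
  also have "(\<Sum>r\<in>(\<lambda>u. (x - u, h + 1)) ` ?U. climb_cost q s r * \<Phi> r) = (\<Sum>u\<in>?U. \<Phi> (x - u, h + 1))"
    by (subst sum.reindex) (auto simp: inj_on_def climb_cost_def s)
  finally show ?thesis using sides climb by (simp add: algebra_simps)
qed

lemma prob_lipschitz_above_eq_1:
  fixes b :: "int ^ 'd::finite \<Rightarrow> int" and \<alpha> p :: real
  assumes \<alpha>: "0 \<le> \<alpha>" "\<alpha> < 1" and b: "\<And>x. b x \<le> \<alpha> * norm1 x"
    and p: "p \<le> 1" "1 - p < 1 / 2 * (4 * real CARD('d)) powr (- (1 / (1 - \<alpha>)))"
  shows "measure (percolation_measure p) (lipschitz_above b) = 1"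
proof -
  let ?P = "percolation_measure p"
  define n where "n = 4 * real CARD('d)"
  have "CARD('d) > 0" by simp
  then have n: "n > 1" unfolding n_def by linarith
  define t where "t = n powr (1 / (1 - \<alpha>))"
  have t: "t > 1" unfolding t_def using n \<alpha> by (intro gr_one_powr) auto
  have t_sides: "t powr (\<alpha> - 1) = 1 / n"
  proof -
    have "1 / (1 - \<alpha>) * (\<alpha> - 1) = -1" using \<alpha> by (simp add: field_simps)
    then show ?thesis using n by (simp add: t_def powr_powr powr_minus_divide)
  qed
  have qt: "1 - p < 1 / (2 * t)"
    using p(2) by (simp add: t_def n_def powr_minus_divide)
  have "1 / (2 * t) \<le> 1" using t by simp
  with qt have p0: "0 \<le> p" by linarith
  define \<rho> where "\<rho> = (1 - p) * t + 1 / 2"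
  have "(1 - p) * t < 1 / 2" using qt t by (simp add: field_simps)
  moreover have "0 \<le> (1 - p) * t" using t p by simp
  ultimately have \<rho>: "0 \<le> \<rho>" "\<rho> < 1" by (auto simp: \<rho>_def)
  define \<Phi> where "\<Phi> s = t powr (\<alpha> * norm1 (fst s) - snd s)" for s :: "'d site"
  have reach: "measure ?P {\<omega>. reachable \<omega> b s} \<le> \<Phi> s / (1 - \<rho>)" for s
  proof (rule prob_reachable_le[OF p0 p(1) \<rho>])
    fix x h assume "h \<le> b x"
    then have "real_of_int h \<le> \<alpha> * norm1 x" using b[of x] by linarith
    then show "\<Phi> (x, h) \<ge> 1" using t by (simp add: \<Phi>_def ge_one_powr_ge_zero)
  next
    fix s :: "'d site"
    show "(\<Sum>r\<in>back_steps s. climb_cost (1 - p) s r * \<Phi> r) \<le> \<rho> * \<Phi> s"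
      unfolding \<Phi>_def \<rho>_def
      by (rule superharmonic_potential) (use \<alpha> t t_sides in \<open>auto simp: n_def\<close>)
  qed (simp add: \<Phi>_def)
  have null: "measure ?P {\<omega>. \<forall>h. reachable \<omega> b (x, h)} = 0" for x
  proof -
    have lim: "(\<lambda>k. \<Phi> (x, int k) / (1 - \<rho>)) \<longlonglongrightarrow> 0"
    proof -
      have "\<Phi> (x, int k) / (1 - \<rho>) = (1 / t) ^ k * (t powr (\<alpha> * norm1 x) / (1 - \<rho>))" for k
        using t by (simp add: \<Phi>_def powr_diff powr_realpow power_divide)
      moreover have "(\<lambda>k. (1 / t) ^ k * (t powr (\<alpha> * norm1 x) / (1 - \<rho>))) \<longlonglongrightarrow> 0"
        using t by (intro tendsto_mult_left_zero LIMSEQ_power_zero) auto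
      ultimately show ?thesis by (simp only:)
    qed
    have "measure ?P {\<omega>. \<forall>h. reachable \<omega> b (x, h)} \<le> \<Phi> (x, int k) / (1 - \<rho>)" for k
    proof -
      have "measure ?P {\<omega>. \<forall>h. reachable \<omega> b (x, h)} \<le> measure ?P {\<omega>. reachable \<omega> b (x, int k)}"
        by (intro percolation.finite_measure_mono sets_percolation_Collect) auto
      then show ?thesis using reach order_trans by blast
    qed
    then have "measure ?P {\<omega>. \<forall>h. reachable \<omega> b (x, h)} \<le> 0"
      using lim by (intro LIMSEQ_le_const) auto
    then show ?thesis by (simp add: measure_le_0_iff)
  qed
  have "AE \<omega> in ?P. \<exists>h. \<not> reachable \<omega> b (x, h)" for x
  proof -
    have "{\<omega>. \<forall>h. reachable \<omega> b (x, h)} \<in> sets ?P"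
      by (rule sets_percolation_Collect) measurable
    from percolation.prob_eq_0[OF this] null[of x] show ?thesis by simp
  qed
  then have "AE \<omega> in ?P. \<omega> \<in> lipschitz_above b"
    unfolding lipschitz_above_iff by (simp add: AE_all_countable)
  then show ?thesis
    by (simp add: percolation.prob_eq_1[OF lipschitz_above_sets])
qed

section \<open>Surfaces do not exist for few open sites\<close>

text \<open>
  Over a line in direction \<open>i\<close>, an open Lipschitz surface of known height at the origin contains
  one of at most \<open>3 ^ k\<close> walks of \<open>k\<close> steps, each of which is open with probability at most \<open>p ^ k\<close>.
\<close>

definition right_steps :: "'d::finite \<Rightarrow> 'd site \<Rightarrow> 'd site set" where
  "right_steps i s = (\<lambda>\<delta>. (fst s + axis i 1, snd s + \<delta>)) ` {-1, 0, 1}"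

lemma card_right_walks_le: "card (walks (right_steps i) k s) \<le> 3 ^ k"
proof -
  have weight: "walk_weight (\<lambda>_ _. 1) w = 1" for w :: "'a site list"
    by (induction "\<lambda>(_ :: 'a site) (_ :: 'a site). 1 :: real" w rule: walk_weight.induct) auto
  have "card (right_steps i s) \<le> 3" for s :: "'a site"
    unfolding right_steps_def by (rule card_image_le[THEN order_trans]) auto
  then have "(\<Sum>w\<in>walks (right_steps i) k s. walk_weight (\<lambda>_ _. 1) w * 1) \<le> 3 ^ k * 1"
    by (intro first_moment) (auto simp: right_steps_def simp flip: of_nat_le_iff)
  then show ?thesis by (simp add: weight flip: of_nat_le_iff)
qed

lemma right_walk_distinct: "w \<in> walks (right_steps i) k s \<Longrightarrow> distinct w"
proof -
  assume "w \<in> walks (right_steps i) k s"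
  then have "successively (\<lambda>s t. fst s $ i < fst t $ i) w"
    by (auto simp: walks_def right_steps_def elim!: successively_mono)
  then have "sorted_wrt (\<lambda>s t. fst s $ i < fst t $ i) w"
    by (subst (asm) successively_conv_sorted_wrt) (auto simp: transp_def)
  then show "distinct w"
    by (induction w) auto
qed

lemma right_walk_along_surface:
  assumes "lipschitz_fun F" and "\<And>x. \<omega> (x, F x)"
  shows "\<exists>w\<in>walks (right_steps i) k (x, F x). \<forall>s\<in>set w. \<omega> s"
proof (induction k arbitrary: x)
  case (Suc k)
  let ?y = "x + axis i 1"
  obtain w where w: "w \<in> walks (right_steps i) k (?y, F ?y)" "\<forall>s\<in>set w. \<omega> s"
    using Suc by blast
  have "norm1 (?y - x) = 1"
    by (simp add: norm1_def axis_def if_distrib cong: if_cong)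
  then have "\<bar>F ?y - F x\<bar> \<le> 1" using assms(1) by (simp only: lipschitz_fun_def)
  then have "F ?y - F x \<in> {-1, 0, 1}" by auto
  then have "(?y, F ?y) \<in> right_steps i (x, F x)"
    unfolding right_steps_def by (intro image_eqI[of _ _ "F ?y - F x"]) auto
  then show ?case
    using w assms(2) by (intro bexI[of _ "(x, F x) # w"]) (auto simp: walks_Suc)
qed (use assms in \<open>simp add: walks_0\<close>)

lemma prob_lipschitz_above_eq_0:
  fixes b :: "int ^ 'd::finite \<Rightarrow> int" and p :: real
  assumes p: "0 \<le> p" "p < 1 / 3"
  shows "measure (percolation_measure p) (lipschitz_above b) = 0"
proof -
  let ?P = "percolation_measure p"
  obtain i :: 'd where True by simp
  define W where "W k h = walks (right_steps i) k ((0, h) :: 'd site)" for k h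
  define B where "B k h = (\<Union>w\<in>W k h. {\<omega>. \<forall>s\<in>set w. \<omega> s = True})" for k h
  have finW: "finite (W k h)" for k h
    unfolding W_def by (rule finite_walks) (simp add: right_steps_def)
  have open_sets: "{\<omega>. \<forall>s\<in>set w. \<omega> s = True} \<in> sets ?P" for w
    by (rule sets_percolation_Collect) measurable
  have B_sets: "B k h \<in> sets ?P" for k h
    unfolding B_def using finW open_sets by (intro sets.finite_UN) auto
  have B_le: "measure ?P (B k h) \<le> (3 * p) ^ k" for k h
  proof -
    have "measure ?P (B k h) \<le> (\<Sum>w\<in>W k h. measure ?P {\<omega>. \<forall>s\<in>set w. \<omega> s = True})"
      unfolding B_def using finW open_sets
      by (intro percolation.finite_measure_subadditive_finite) auto
    also have "\<dots> \<le> (\<Sum>w\<in>W k h. p ^ k)"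
    proof (rule sum_mono)
      fix w assume "w \<in> W k h"
      then have "card (set w) = Suc k"
        using right_walk_distinct distinct_card by (fastforce simp: W_def walks_def)
      then have "measure ?P {\<omega>. \<forall>s\<in>set w. \<omega> s = True} = p ^ Suc k"
        using prob_states[of "set w" p True] p by simp
      also have "\<dots> \<le> p ^ k" using p by (intro power_decreasing) auto
      finally show "measure ?P {\<omega>. \<forall>s\<in>set w. \<omega> s = True} \<le> p ^ k" .
    qed
    also have "\<dots> = card (W k h) * p ^ k" by simp
    also have "\<dots> \<le> 3 ^ k * p ^ k"
      using card_right_walks_le[of i k "(0, h)"] p
      by (intro mult_right_mono) (auto simp: W_def simp flip: of_nat_le_iff)
    finally show ?thesis by (simp add: power_mult_distrib)
  qed
  have null: "(\<Inter>k. B k h) \<in> null_sets ?P" for h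
  proof -
    have "measure ?P (\<Inter>k. B k h) \<le> (3 * p) ^ k" for k
      using B_le[of k h] B_sets[of k h] percolation.finite_measure_mono[of "\<Inter>k. B k h" "B k h" p]
      by fastforce
    moreover have "(\<lambda>k. (3 * p) ^ k) \<longlonglongrightarrow> 0"
      using p by (intro LIMSEQ_power_zero) auto
    ultimately have "measure ?P (\<Inter>k. B k h) \<le> 0"
      by (intro LIMSEQ_le_const) auto
    then have "measure ?P (\<Inter>k. B k h) = 0" by (simp add: measure_le_0_iff)
    moreover have "(\<Inter>k. B k h) \<in> sets ?P" using B_sets by (intro sets.countable_INT) auto
    ultimately show ?thesis
      by (simp add: null_sets_def percolation.emeasure_eq_measure)
  qed
  have "lipschitz_above b \<subseteq> (\<Union>h. \<Inter>k. B k h)"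
  proof
    fix \<omega> assume "\<omega> \<in> lipschitz_above b"
    then obtain F where F: "lipschitz_fun F" "\<And>x. \<omega> (x, F x)"
      by (auto simp: lipschitz_above_def)
    have "\<exists>w\<in>W k (F 0). \<forall>s\<in>set w. \<omega> s" for k
      unfolding W_def by (rule right_walk_along_surface) (use F in auto)
    then show "\<omega> \<in> (\<Union>h. \<Inter>k. B k h)" by (auto simp: B_def)
  qed
  moreover have "(\<Union>h. \<Inter>k. B k h) \<in> null_sets ?P"
    by (rule null_sets_UN) (rule null)
  ultimately have "lipschitz_above b \<in> null_sets ?P"
    using lipschitz_above_sets null_sets_subset by blast
  then show ?thesis by (simp add: null_sets_def measure_def)
qed

section \<open>The critical probability\<close>

definition slope :: "int ^ 'd::finite \<Rightarrow> int ^ 'd \<Rightarrow> int" where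
  "slope \<eta> x = (\<Sum>i\<in>UNIV. \<eta> $ i * x $ i)"

lemma LIP_eq: "LIP \<alpha> \<eta> = lipschitz_above (\<lambda>x. \<lfloor>\<alpha> * of_int (slope \<eta> x)\<rfloor>)"
  by (simp add: LIP_def lipschitz_above_def slope_def)

lemma slope_le_norm1:
  assumes "\<eta> \<in> sign_vectors"
  shows "slope \<eta> x \<le> norm1 x"
  unfolding slope_def norm1_def
proof (rule sum_mono)
  fix i
  have "\<eta> $ i \<in> {-1, 0, 1}" using assms by (simp add: sign_vectors_def)
  then show "\<eta> $ i * x $ i \<le> \<bar>x $ i\<bar>" by auto
qed

lemma full_sign_vector_entries:
  assumes "\<eta> \<in> sign_vectors" and "norm1 (\<eta> :: int ^ 'd::finite) = int CARD('d)"
  shows "\<eta> $ i = 1 \<or> \<eta> $ i = -1"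
proof -
  have le: "\<bar>\<eta> $ j\<bar> \<le> 1" for j
  proof -
    have "\<eta> $ j \<in> {-1, 0, 1}" using assms(1) by (simp add: sign_vectors_def)
    then show ?thesis by auto
  qed
  have "(\<Sum>j\<in>UNIV. 1 - \<bar>\<eta> $ j\<bar>) = 0"
    using assms(2) by (simp add: norm1_def sum_subtractf)
  then have "1 - \<bar>\<eta> $ i\<bar> = 0"
    using le by (subst (asm) sum_nonneg_eq_0_iff) auto
  then show ?thesis by linarith
qed

text \<open>
  The involution \<open>r\<close> flips the coordinates in which \<open>\<eta>\<close> and \<open>\<eta>'\<close> differ; it preserves \<open>norm1\<close>
  and exchanges the two hyperplanes.
\<close>

lemma measure_LIP_reflect:
  fixes \<eta> \<eta>' :: "int ^ 'd::finite"
  assumes "\<And>i. \<eta> $ i = 1 \<or> \<eta> $ i = -1" "\<And>i. \<eta>' $ i = 1 \<or> \<eta>' $ i = -1"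
  shows "measure (percolation_measure p) (LIP \<alpha> \<eta>) = measure (percolation_measure p) (LIP \<alpha> \<eta>')"
proof -
  define r :: "int ^ 'd \<Rightarrow> int ^ 'd" where "r x = (\<chi> i. \<eta> $ i * \<eta>' $ i * x $ i)" for x
  define f :: "'d site \<Rightarrow> 'd site" where "f s = (r (fst s), snd s)" for s
  have sq: "\<eta> $ i * \<eta> $ i = 1" "\<eta>' $ i * \<eta>' $ i = 1" for i
    using assms(1)[of i] assms(2)[of i] by auto
  have unit: "\<bar>\<eta> $ i\<bar> = 1" "\<bar>\<eta>' $ i\<bar> = 1" for i
    using assms(1)[of i] assms(2)[of i] by auto
  have rr: "r (r x) = x" for x
  proof -
    have "\<eta> $ i * \<eta>' $ i * (\<eta> $ i * \<eta>' $ i * x $ i) = (\<eta> $ i * \<eta> $ i) * (\<eta>' $ i * \<eta>' $ i) * x $ i" for i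
      by (simp only: mult_ac)
    then show ?thesis by (simp add: r_def vec_eq_iff sq)
  qed
  have r_norm: "norm1 (r x - r y) = norm1 (x - y)" for x y
    unfolding norm1_def
    by (rule sum.cong) (auto simp: r_def abs_mult unit simp flip: right_diff_distrib)
  have r_slope: "slope \<eta> (r x) = slope \<eta>' x" "slope \<eta>' (r x) = slope \<eta> x" for x
  proof -
    have "\<eta> $ i * (\<eta> $ i * \<eta>' $ i * x $ i) = \<eta>' $ i * x $ i"
      "\<eta>' $ i * (\<eta> $ i * \<eta>' $ i * x $ i) = \<eta> $ i * x $ i" for i
      using sq[of i] by (metis mult.assoc mult.commute mult_1)+
    then show "slope \<eta> (r x) = slope \<eta>' x" "slope \<eta>' (r x) = slope \<eta> x"
      by (simp_all only: slope_def r_def vec_lambda_beta)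
  qed
  have reflect: "\<omega> \<circ> f \<in> LIP \<alpha> \<beta>'"
    if \<omega>: "\<omega> \<in> LIP \<alpha> \<beta>" and slope: "\<And>x. slope \<beta> (r x) = slope \<beta>' x" for \<omega> \<beta> \<beta>'
  proof -
    obtain F where "lipschitz_fun F" "\<And>x. \<omega> (x, F x) \<and> F x > \<lfloor>\<alpha> * of_int (slope \<beta> x)\<rfloor>"
      using \<omega> by (auto simp: LIP_eq lipschitz_above_def)
    then show ?thesis
      unfolding LIP_eq lipschitz_above_def
      by (intro CollectI exI[of _ "F \<circ> r"]) (auto simp: lipschitz_fun_def f_def r_norm simp flip: slope)
  qed
  have "\<omega> \<circ> f \<circ> f = \<omega>" for \<omega> :: "'d config"
    by (simp add: f_def fun_eq_iff rr)
  then have "{\<omega>. \<omega> \<circ> f \<in> LIP \<alpha> \<eta>'} = LIP \<alpha> \<eta>"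
    using reflect[of _ \<eta> \<eta>'] reflect[of _ \<eta>' \<eta>] r_slope by (metis (mono_tags) Collect_eqI Collect_mem_eq)
  moreover have "inj f" by (rule inj_on_inverseI[of _ f]) (simp add: f_def rr)
  ultimately show ?thesis
    using measure_reindex[of f "LIP \<alpha> \<eta>'" p] by (simp add: LIP_eq lipschitz_above_sets)
qed

lemma zero_one_threshold:
  fixes f :: "real \<Rightarrow> real"
  assumes zero_one: "\<And>p. 0 \<le> p \<Longrightarrow> p \<le> 1 \<Longrightarrow> f p = 0 \<or> f p = 1"
    and mono: "\<And>p p'. 0 \<le> p \<Longrightarrow> p \<le> p' \<Longrightarrow> p' \<le> 1 \<Longrightarrow> f p \<le> f p'"
    and low: "0 \<le> a" "a \<le> 1" "f a = 0" and high: "\<And>p. u < p \<Longrightarrow> p \<le> 1 \<Longrightarrow> f p = 1"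
    and u: "0 \<le> u" "u < 1"
  obtains c where "a \<le> c" "c \<le> u" "\<And>p. 0 \<le> p \<Longrightarrow> p < c \<Longrightarrow> f p = 0"
    "\<And>p. c < p \<Longrightarrow> p \<le> 1 \<Longrightarrow> f p = 1"
proof
  define Z where "Z = {p. 0 \<le> p \<and> p \<le> 1 \<and> f p = 0}"
  have a: "a \<in> Z" using low by (simp add: Z_def)
  have Z_le: "z \<le> u" if "z \<in> Z" for z
    using that high[of z] by (force simp: Z_def)
  then have bdd: "bdd_above Z" by (meson bdd_aboveI)
  show "a \<le> Sup Z" using a bdd by (rule cSup_upper)
  show Su: "Sup Z \<le> u" using a Z_le by (intro cSup_least) auto
  show "f p = 0" if p: "0 \<le> p" "p < Sup Z" for p
  proof -
    obtain z where "z \<in> Z" "p < z" using less_cSup_iff[of Z p] a bdd p by blast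
    then show ?thesis
      using mono[of p z] zero_one[of p] p by (auto simp: Z_def)
  qed
  show "f p = 1" if p: "Sup Z < p" "p \<le> 1" for p
  proof -
    have "p \<notin> Z" using p bdd cSup_upper by fastforce
    moreover have "0 \<le> p" using p(1) a bdd cSup_upper[of a Z] low(1) by linarith
    ultimately show ?thesis using zero_one[of p] p by (auto simp: Z_def)
  qed
qed

lemma critical_probability_unique:
  assumes "critical_probability \<alpha> \<eta> c" "critical_probability \<alpha> \<eta> c'"
  shows "c = c'"
proof -
  have "\<not> c < c'" if crit: "critical_probability \<alpha> \<eta> c" "critical_probability \<alpha> \<eta> c'" for c c'
  proof
    assume "c < c'"
    then obtain p where p: "c < p" "p < c'" using dense by blast
    moreover have "0 \<le> p" "p \<le> 1"
      using p crit by (auto simp: critical_probability_def)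
    ultimately have "measure (percolation_measure p) (LIP \<alpha> \<eta>) = 1"
      "measure (percolation_measure p) (LIP \<alpha> \<eta>) = 0"
      using crit by (auto simp: critical_probability_def)
    then show False by simp
  qed
  with assms show ?thesis by (meson linorder_neqE_linordered_idom)
qed

theorem proposition3p1:
  fixes \<alpha> :: real
  assumes "0 \<le> \<alpha>" and "\<alpha> < 1"
  shows "q_L TYPE('d::finite) \<alpha> CARD('d)
    \<ge> 1 / 2 * (4 * real CARD('d)) powr (- (1 / (1 - \<alpha>)))"
proof -
  define g where "g = 1 / 2 * (4 * real CARD('d)) powr (- (1 / (1 - \<alpha>)))"
  define ones :: "int ^ 'd" where "ones = (\<chi> i. 1)"
  have ones: "ones \<in> sign_vectors" "norm1 ones = int CARD('d)"
    by (auto simp: ones_def sign_vectors_def norm1_def)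
  let ?f = "\<lambda>p. measure (percolation_measure p) (LIP \<alpha> ones)"
  have g: "0 < g" "g \<le> 1 / 2"
  proof -
    have "CARD('d) > 0" by simp
    then have "1 \<le> 4 * real CARD('d)" by linarith
    then have "(4 * real CARD('d)) powr (- (1 / (1 - \<alpha>))) \<le> (4 * real CARD('d)) powr 0"
      using assms by (intro powr_mono) auto
    then show "0 < g" "g \<le> 1 / 2" by (auto simp: g_def)
  qed
  have floor_le: "\<lfloor>\<alpha> * of_int (slope ones x)\<rfloor> \<le> \<alpha> * norm1 x" for x
  proof -
    have "\<alpha> * of_int (slope ones x) \<le> \<alpha> * norm1 x"
      using assms slope_le_norm1[OF ones(1), of x] by (intro mult_left_mono) auto
    then show ?thesis by linarith
  qed
  \<comment> \<open>Any number between 0 and \<open>1 / 3\<close> can serve as the lower end of the search interval.\<close>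
  obtain c where c: "1 / 4 \<le> c" "c \<le> 1 - g" "\<And>p. 0 \<le> p \<Longrightarrow> p < c \<Longrightarrow> ?f p = 0"
    "\<And>p. c < p \<Longrightarrow> p \<le> 1 \<Longrightarrow> ?f p = 1"
  proof (rule zero_one_threshold[of ?f "1 / 4" "1 - g"])
    show "?f p = 0 \<or> ?f p = 1" for p
      unfolding LIP_eq by (rule zero_one_lipschitz_above)
    show "?f p \<le> ?f p'" if "0 \<le> p" "p \<le> p'" "p' \<le> 1" for p p'
      unfolding LIP_eq
      by (rule measure_mono_parameter[OF lipschitz_above_sets lipschitz_above_increasing that])
    show "?f (1 / 4) = 0" unfolding LIP_eq by (rule prob_lipschitz_above_eq_0) auto
    show "?f p = 1" if "1 - g < p" "p \<le> 1" for p
      unfolding LIP_eq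
      by (rule prob_lipschitz_above_eq_1[OF assms floor_le]) (use that in \<open>auto simp: g_def\<close>)
  qed (use g in auto)
  have critical: "critical_probability \<alpha> \<eta> c"
    if "\<eta> \<in> sign_vectors" "norm1 \<eta> = int CARD('d)" for \<eta> :: "int ^ 'd"
    using c g measure_LIP_reflect[OF full_sign_vector_entries[OF that] full_sign_vector_entries[OF ones]]
    by (auto simp: critical_probability_def)
  have "p_L TYPE('d) \<alpha> CARD('d) = c"
    unfolding p_L_def
    by (rule the_equality) (use critical critical_probability_unique ones in blast)+
  then show ?thesis using c(2) by (simp add: q_L_def g_def)
qed

end
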